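(* For every integer $i\ge1$ and all $t\ne0$, $$\biggl(\frac1{e^{t}-1}\biggr)^{(i)}=\sum_{m=1}^{i+1}\frac{\mu_{i,m}}{(1-e^{-t})^m},$$ where $\mu_{i,m}=(-1)^{m+1}(m-1)!\,S(i+1,m)$ for $1\le m\le i+1$.
   Context: $t$ is a real variable. For a function $f$ of $t$, $f^{(n)}$ denotes the $n$-th derivative with respect to $t$. For $1\le m\le n$, $S(n,m)=\frac1{m!}\sum_{\ell=0}^m(-1)^{m-\ell}\binom{m}{\ell}\ell^{n}$ are the Stirling numbers of the second kind. *)

theory Defs
  imports "HOL-Analysis.Analysis" "HOL-Combinatorics.Stirling"
begin

text \<open>
  The library introduces the Stirling numbers of the second kind by their triangular recurrence.
  The following lemma identifies them with the explicit alternating sum.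
\<close>

lemma Stirling_explicit_aux:
  "fact m * real (Stirling n m) =
     (\<Sum>l=0..m. (-1) ^ (m - l) * real (m choose l) * real l ^ n)"
proof (induction n arbitrary: m)
  case 0
  show ?case
  proof (cases m)
    case 0
    then show ?thesis by simp
  next
    case (Suc k)
    have "(\<Sum>l=0..m. (-1) ^ (m - l) * real (m choose l) * real l ^ 0)
        = (\<Sum>l\<le>m. real (m choose l) * 1 ^ l * (-1) ^ (m - l))"
      by (simp add: atMost_atLeast0 mult.commute)
    also have "\<dots> = (1 + (-1)) ^ m"
      by (rule binomial_ring [symmetric])
    finally show ?thesis using Suc by simp
  qed
next
  case (Suc n)
  show ?case
  proof (cases m)
    case 0
    then show ?thesis by simp
  next
    case (Suc k)
    have term_eq: "(-1) ^ (Suc k - l) * real (Suc k choose l) * real l ^ Suc n =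
        real (Suc k) * ((-1) ^ (Suc k - l) * real (Suc k choose l) * real l ^ n)
        - real (Suc k) * ((-1) ^ (Suc k - l) * real (k choose l) * real l ^ n)" for l
    proof (cases l)
      case 0
      then show ?thesis by simp
    next
      case (Suc j)
      have "real l * real (Suc k choose l) = real (Suc k) * real (k choose j)"
        using Suc_times_binomial [of j k] unfolding Suc by (metis of_nat_mult)
      moreover have "real (k choose j) = real (Suc k choose l) - real (k choose l)"
        unfolding Suc by simp
      ultimately have *: "real l * real (Suc k choose l)
          = real (Suc k) * (real (Suc k choose l) - real (k choose l))"
        by simp
      have "(-1) ^ (Suc k - l) * real (Suc k choose l) * real l ^ Suc n
          = (-1) ^ (Suc k - l) * real l ^ n * (real l * real (Suc k choose l))"
        by simp
      also have "\<dots> = (-1) ^ (Suc k - l) * real l ^ n *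
          (real (Suc k) * (real (Suc k choose l) - real (k choose l)))"
        by (simp only: *)
      finally show ?thesis
        by (simp only: algebra_simps)
    qed
    have "(\<Sum>l=0..Suc k. (-1) ^ (Suc k - l) * real (k choose l) * real l ^ n)
        = (\<Sum>l=0..k. (-1) ^ (Suc k - l) * real (k choose l) * real l ^ n)"
      by simp
    also have "\<dots> = (\<Sum>l=0..k. - ((-1) ^ (k - l) * real (k choose l) * real l ^ n))"
      by (rule sum.cong) (auto simp: Suc_diff_le)
    also have "\<dots> = - (fact k * real (Stirling n k))"
      by (simp add: Suc.IH sum_negf)
    finally have shifted:
      "(\<Sum>l=0..Suc k. (-1) ^ (Suc k - l) * real (k choose l) * real l ^ n)
        = - (fact k * real (Stirling n k))" .
    have "(\<Sum>l=0..Suc k. (-1) ^ (Suc k - l) * real (Suc k choose l) * real l ^ Suc n)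
        = real (Suc k) * (fact (Suc k) * real (Stirling n (Suc k)))
          + real (Suc k) * (fact k * real (Stirling n k))"
      unfolding term_eq sum_subtractf sum_distrib_left [symmetric] shifted Suc.IH [symmetric]
      by simp
    also have "\<dots> = fact (Suc k) * real (Stirling (Suc n) (Suc k))"
      by (simp add: algebra_simps)
    finally show ?thesis using Suc by simp
  qed
qed

lemma Stirling_explicit:
  "real (Stirling n m) =
     1 / fact m * (\<Sum>l=0..m. (-1) ^ (m - l) * real (m choose l) * real l ^ n)"
  by (simp flip: Stirling_explicit_aux)

definition mu :: "nat \<Rightarrow> nat \<Rightarrow> real" where
  "mu i m = (-1) ^ (m + 1) * fact (m - 1) * real (Stirling (i + 1) m)"

end

theory Submission
  imports Defs
begin

text \<open>
  Put $u = 1 / (1 - e^{-t})$. This function satisfies the Riccati equation $u' = u - u^2$, and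
  $1 / (e^t - 1) = u - 1$. Hence every derivative of $1 / (e^t - 1)$ is a polynomial in $u$, and
  differentiating once more acts on polynomials in $u$ as the operator $(u - u^2)\, d/du$. On
  coefficients this operator sends $(a_m)$ to $(m\, a_m - (m - 1)\, a_{m-1})$. After the factor
  $(-1)^{m+1} (m-1)!$ is split off, that is exactly the triangular recurrence
  $S(n+1,m) = m\, S(n,m) + S(n,m-1)$, as \<open>mu_Suc_Suc\<close> shows. So the coefficients of the successive
  derivatives are the numbers $\mu_{i,m}$, starting from $u$ itself, whose only coefficient is
  $\mu_{0,1} = 1$. The two functions $u$ and $u - 1$ differ by a constant, which disappears at the
  first derivative; this is why the formula begins at $i = 1$.
\<close>

lemma mu_Suc_1: "mu (Suc i) 1 = mu i 1"
  by (simp add: mu_def)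

lemma mu_eq_0: "i + 1 < m \<Longrightarrow> mu i m = 0"
  by (simp add: mu_def)

lemma mu_Suc_Suc:
  "mu (Suc i) (Suc (Suc k)) = real (Suc (Suc k)) * mu i (Suc (Suc k)) - real (Suc k) * mu i (Suc k)"
  by (simp add: mu_def algebra_simps)

text \<open>
  The operator $(u - u^2)\, d/du$ raises the index $i$ by one in the polynomial
  $\sum_m \mu_{i,m} u^m$. The summation index is shifted, $m = k + 1$, so that the exponent
  $m - 1$ of the differentiated power is the index itself.
\<close>

lemma sum_mu_Suc:
  fixes u :: real
  shows "(\<Sum>k\<le>i. mu i (Suc k) * (real (Suc k) * u ^ k * (u - u\<^sup>2))) =
    (\<Sum>k\<le>Suc i. mu (Suc i) (Suc k) * u ^ Suc k)"
proof -
  define a where "a k = real (Suc k) * mu i (Suc k)" for k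
  have a_top: "a (Suc i) = 0"
    by (simp add: a_def mu_eq_0)
  have "(\<Sum>k\<le>i. mu i (Suc k) * (real (Suc k) * u ^ k * (u - u\<^sup>2))) =
      (\<Sum>k\<le>i. a k * u ^ Suc k) - (\<Sum>k\<le>i. a k * u ^ Suc (Suc k))"
    unfolding sum_subtractf [symmetric]
    by (rule sum.cong) (simp_all add: a_def algebra_simps power2_eq_square)
  also have "(\<Sum>k\<le>i. a k * u ^ Suc k) = (\<Sum>k\<le>Suc i. a k * u ^ Suc k)"
    by (simp add: a_top)
  also have "\<dots> = a 0 * u + (\<Sum>k\<le>i. a (Suc k) * u ^ Suc (Suc k))"
    by (subst sum.atMost_Suc_shift) simp
  also have "\<dots> - (\<Sum>k\<le>i. a k * u ^ Suc (Suc k)) =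
      a 0 * u + (\<Sum>k\<le>i. (a (Suc k) - a k) * u ^ Suc (Suc k))"
    by (simp add: sum_subtractf left_diff_distrib)
  also have "\<dots> = (\<Sum>k\<le>Suc i. mu (Suc i) (Suc k) * u ^ Suc k)"
    by (subst sum.atMost_Suc_shift) (simp add: a_def mu_Suc_Suc mu_Suc_1 [simplified])
  finally show ?thesis .
qed

lemma has_field_derivative_inverse_one_minus_exp:
  fixes t :: real
  assumes "t \<noteq> 0"
  shows "((\<lambda>t. 1 / (1 - exp (- t))) has_field_derivative
    1 / (1 - exp (- t)) - (1 / (1 - exp (- t)))\<^sup>2) (at t)"
proof -
  have nz: "1 - exp (- t) \<noteq> 0"
    using assms by simp
  have "((\<lambda>t. 1 / (1 - exp (- t))) has_field_derivative
      - exp (- t) / (1 - exp (- t))\<^sup>2) (at t)"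
    using nz by (auto intro!: derivative_eq_intros simp: power2_eq_square)
  moreover have "- (1 - w) / w\<^sup>2 = 1 / w - (1 / w)\<^sup>2" if "w \<noteq> 0" for w :: real
    using that by (simp add: field_simps power2_eq_square)
  from this [OF nz] have "- exp (- t) / (1 - exp (- t))\<^sup>2 =
      1 / (1 - exp (- t)) - (1 / (1 - exp (- t)))\<^sup>2"
    by simp
  ultimately show ?thesis
    by simp
qed

lemma inverse_exp_minus_one:
  fixes t :: real
  assumes "t \<noteq> 0"
  shows "1 / (exp t - 1) = 1 / (1 - exp (- t)) - 1"
  using assms by (simp add: exp_minus field_simps)

lemma has_field_derivative_sum_mu:
  fixes t :: real
  assumes "t \<noteq> 0"
  shows "((\<lambda>t. \<Sum>k\<le>i. mu i (Suc k) * (1 / (1 - exp (- t))) ^ Suc k) has_field_derivative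
    (\<Sum>k\<le>Suc i. mu (Suc i) (Suc k) * (1 / (1 - exp (- t))) ^ Suc k)) (at t)"
  unfolding sum_mu_Suc [symmetric]
  by (intro DERIV_sum DERIV_cmult
      DERIV_power_Suc [OF has_field_derivative_inverse_one_minus_exp [OF assms], THEN DERIV_cong])
    (simp add: algebra_simps add_divide_distrib)

text \<open>
  The induction carries the derivative of the $n$-th iterate, at every nonzero point: equality of
  the iterate with the sum at $t$ alone would not determine its derivative there, and \<open>deriv\<close> says
  nothing unless differentiability is known. Transferring the derivative from one function to the
  other uses that the nonzero reals form an open set.
\<close>

lemma has_field_derivative_deriv_funpow:
  fixes t :: real
  assumes "t \<noteq> 0"
  shows "((deriv ^^ n) (\<lambda>t. 1 / (exp t - 1)) has_field_derivative
    (\<Sum>k\<le>Suc n. mu (Suc n) (Suc k) * (1 / (1 - exp (- t))) ^ Suc k)) (at t)"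
  using assms
proof (induction n arbitrary: t)
  case 0
  have "((\<lambda>t::real. (\<Sum>k\<le>0. mu 0 (Suc k) * (1 / (1 - exp (- t))) ^ Suc k) - 1)
      has_field_derivative
      (\<Sum>k\<le>Suc 0. mu (Suc 0) (Suc k) * (1 / (1 - exp (- t))) ^ Suc k) - 0) (at t)"
    by (intro DERIV_diff has_field_derivative_sum_mu 0 DERIV_const)
  then have "((\<lambda>t. 1 / (exp t - 1)) has_field_derivative
      (\<Sum>k\<le>Suc 0. mu (Suc 0) (Suc k) * (1 / (1 - exp (- t))) ^ Suc k) - 0) (at t)"
    by (rule has_field_derivative_transform_within_open [where S = "- {0}"])
      (use 0 in \<open>auto simp: mu_def inverse_exp_minus_one\<close>)
  then show ?case
    by simp
next
  case (Suc n)
  have "(deriv ^^ Suc n) (\<lambda>t. 1 / (exp t - 1)) s =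
      (\<Sum>k\<le>Suc n. mu (Suc n) (Suc k) * (1 / (1 - exp (- s))) ^ Suc k)" if "s \<noteq> 0" for s :: real
    using DERIV_imp_deriv [OF Suc.IH [OF that]] by simp
  then show ?case
    by (intro has_field_derivative_transform_within_open
        [where S = "- {0}", OF has_field_derivative_sum_mu [OF Suc.prems]])
      (use Suc.prems in auto)
qed

theorem corollary2p2:
  fixes i :: nat and t :: real
  assumes "i \<ge> 1" and "t \<noteq> 0"
  shows "(deriv ^^ (i - 1)) (\<lambda>t::real. 1 / (exp t - 1)) differentiable (at t) \<and>
    (deriv ^^ i) (\<lambda>t::real. 1 / (exp t - 1)) t =
      (\<Sum>m=1..i+1. mu i m / (1 - exp (- t)) ^ m)"
proof -
  obtain n where i: "i = Suc n"
    using assms(1) by (cases i) auto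
  note D = has_field_derivative_deriv_funpow [OF assms(2), of n]
  have "(\<Sum>k\<le>i. mu i (Suc k) * (1 / (1 - exp (- t))) ^ Suc k) =
      (\<Sum>m=1..i+1. mu i m / (1 - exp (- t)) ^ m)"
    by (simp add: sum.atLeast1_atMost_eq lessThan_Suc_atMost power_one_over
        del: sum.atMost_Suc sum.cl_ivl_Suc power_Suc)
  moreover have "(deriv ^^ i) (\<lambda>t::real. 1 / (exp t - 1)) t =
      (\<Sum>k\<le>i. mu i (Suc k) * (1 / (1 - exp (- t))) ^ Suc k)"
    using DERIV_imp_deriv [OF D] i by simp
  moreover have "(deriv ^^ (i - 1)) (\<lambda>t::real. 1 / (exp t - 1)) differentiable (at t)"
    using D i real_differentiable_def by auto
  ultimately show ?thesis
    by simp
qed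

end
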